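(* Let $(A,B,p,r,c)$ be an LPP situation with producer set $N$ and let $(N,v^{pes})$ be the pessimistic LPP game associated with it, $v^{pes}(S)=\mathrm{value}(S;R^{pes}(S))$ for nonempty $S\subseteq N$ and $v^{pes}(\varnothing)=0$. If $d_N>r$ and $\sum_{i\in N}d_{\{i\}}\ge r$, then $C(v^{pes})\neq\varnothing$.
   Context: LPP situation (linear production situation with a common-pool resource). $N=\{1,\dots,n\}$ is a set of producers, $G=\{1,\dots,g\}$ a set of goods, $Q=\{1,\dots,q\}$ a set of resources; in addition there is one external common-pool resource, of which a total amount $r\ge 0$ is available at unit cost $c\ge 0$. Producer $i$ owns $b^i\in\mathbb{R}_+^q$; $b^S=\sum_{i\in S}b^i$; $B$ is the $q\times n$ matrix with columns $b^i$, and for every $t\in Q$ there is a producer $i$ with $b^i_t>0$. $A$ is a nonnegative $(q+1)\times g$ matrix ($a_{tj}$ is the amount of resource $t$ needed per unit of good $j$; row $q+1$ refers to the common-pool resource), with $a_{(q+1)j}>0$ for all $j\in G$ and, for every $j\in G$, some $t\in Q$ with $a_{tj}>0$. $p\in\mathbb{R}_{++}^g$ is the price vector and $p_j>a_{(q+1)j}c$ for all $j\in G$. For a coalition $S\subseteq N$ and $z\ge 0$, $$\mathrm{value}(S;z)=\max\Big\{\sum_{j=1}^g p_jx_j-cz \;:\; Ax\le \begin{pmatrix} b^S\\ z\end{pmatrix},\ x\in\mathbb{R}^g_+\Big\}.$$ The optimal demand of $S$ is $d_S=\min\{z\ge 0:\ \mathrm{value}(S;z)=\max_{z'\ge 0}\mathrm{value}(S;z')\}$.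 It is assumed that for every nonempty $S$ there is $z$ with $\mathrm{value}(S;z)>0$ (so $d_S>0$). The pessimistic common-pool resource game is $$R^{pes}(S)=\min\Big\{\min_{P:\,S\in P}\Big(r-\sum_{T\in P,\,T\ne S}d_T\Big)_+,\ d_S\Big\},$$ for nonempty $S\subseteq N$, where $P$ ranges over the partitions of $N$ (into nonempty coalitions) containing $S$ and $(a)_+=\max\{a,0\}$. The core of a game $(N,v)$ is $C(v)=\{x\in\mathbb{R}^N: \sum_{i\in N}x_i=v(N),\ \sum_{i\in S}x_i\ge v(S)\ \forall S\subseteq N\}$. *)

theory Defs
  imports "HOL-Analysis.Analysis"
begin

text \<open>
  Producers, goods and privately owned resources are indexed by the finite types
  \<open>'n\<close>, \<open>'g\<close> and \<open>'q\<close>, so that \<open>N = UNIV\<close>. The rows of the \<open>(q+1) \<times> g\<close> matrix \<open>A\<close> are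
  indexed by \<open>'q option\<close>: row \<open>Some t\<close> belongs to the resource \<open>t\<close>, row \<open>None\<close> (the row
  \<open>q+1\<close>) to the common-pool resource. The bundle \<open>b\<^sup>i\<close> is column \<open>i\<close> of \<open>B\<close>.
  The order on vectors is the componentwise one.
\<close>

definition coalition_resources :: "real^'n^'q \<Rightarrow> 'n::finite set \<Rightarrow> real^'q" where
  "coalition_resources B S = (\<Sum>i\<in>S. column i B)"

definition capacity :: "real^'n^'q \<Rightarrow> 'n::finite set \<Rightarrow> real \<Rightarrow> real^('q::finite option)" where
  "capacity B S z =
     (\<chi> t. case t of Some s \<Rightarrow> coalition_resources B S $ s | None \<Rightarrow> z)"

text \<open>
  Maxima and minima over infinite sets of reals are expressed by \<open>GREATEST\<close> and \<open>LEAST\<close>;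
  they are meaningful only where they are attained, which is the case for all
  \<open>z \<ge> 0\<close> in a linear production situation as specified below.
\<close>

definition lp_value ::
  "real^'g^('q::finite option) \<Rightarrow> real^'n^'q \<Rightarrow> real^'g::finite \<Rightarrow> real \<Rightarrow> 'n::finite set \<Rightarrow> real \<Rightarrow> real"
where
  "lp_value A B p c S z =
     (GREATEST v. \<exists>x. v = (\<Sum>j\<in>UNIV. p $ j * x $ j) - c * z \<and> A *v x \<le> capacity B S z \<and> 0 \<le> x)"

definition optimal_demand ::
  "real^'g^('q::finite option) \<Rightarrow> real^'n^'q \<Rightarrow> real^'g::finite \<Rightarrow> real \<Rightarrow> 'n::finite set \<Rightarrow> real"
where
  "optimal_demand A B p c S =
     (LEAST z. 0 \<le> z \<and>
        lp_value A B p c S z = (GREATEST v. \<exists>z'\<ge>0. v = lp_value A B p c S z'))"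

locale lpp_situation =
  fixes A :: "real^'g::finite^('q::finite option)"
    and B :: "real^'n::finite^'q"
    and p :: "real^'g"
    and r c :: real
  assumes r_nonneg: "0 \<le> r"
    and c_nonneg: "0 \<le> c"
    and B_nonneg: "\<And>t i. 0 \<le> B $ t $ i"
    and resource_owned: "\<And>t. \<exists>i. 0 < B $ t $ i"
    and A_nonneg: "\<And>t j. 0 \<le> A $ t $ j"
    and common_pool_needed: "\<And>j. 0 < A $ None $ j"
    and resource_needed: "\<And>j. \<exists>t. 0 < A $ Some t $ j"
    and price_pos: "\<And>j. 0 < p $ j"
    and price_gt_cost: "\<And>j. A $ None $ j * c < p $ j"
    and value_pos: "\<And>S. S \<noteq> {} \<Longrightarrow> \<exists>z\<ge>0. 0 < lp_value A B p c S z"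

text \<open>For nonempty \<open>S\<close> the outer \<open>Min\<close> ranges over a finite nonempty set.\<close>

definition pessimistic_resource ::
  "real^'g^('q::finite option) \<Rightarrow> real^'n^'q \<Rightarrow> real^'g::finite \<Rightarrow> real \<Rightarrow> real \<Rightarrow> 'n::finite set \<Rightarrow> real"
where
  "pessimistic_resource A B p r c S =
     min (Min ((\<lambda>P. max (r - (\<Sum>T\<in>P - {S}. optimal_demand A B p c T)) 0)
                 ` {P. partition_on UNIV P \<and> S \<in> P}))
         (optimal_demand A B p c S)"

definition pessimistic_game ::
  "real^'g^('q::finite option) \<Rightarrow> real^'n^'q \<Rightarrow> real^'g::finite \<Rightarrow> real \<Rightarrow> real \<Rightarrow> 'n::finite set \<Rightarrow> real"
where
  "pessimistic_game A B p r c S =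
     (if S = {} then 0 else lp_value A B p c S (pessimistic_resource A B p r c S))"

definition core :: "('n::finite set \<Rightarrow> real) \<Rightarrow> (real^'n) set" where
  "core v = {x. (\<Sum>i\<in>UNIV. x $ i) = v UNIV \<and> (\<forall>S. (\<Sum>i\<in>S. x $ i) \<ge> v S)}"

end

theory Submission
  imports Defs
begin

text \<open>
  Bound the value functions by a price system. Optimal dual prices \<open>y\<close> of the grand coalition's
  problem with capacities \<open>(b\<^sup>N, r)\<close>, where each unit of good \<open>j\<close> is charged \<open>c\<close> per unit of
  common-pool resource it actually uses, satisfy \<open>value(S; z) \<le> y \<bullet> (b\<^sup>S, z)\<close> for all \<open>S\<close>, with
  equality for \<open>(N, r)\<close>. Since \<open>d\<^sub>N > r\<close> and \<open>value(N; \<cdot>)\<close> is concave, leaving part of \<open>r\<close> unused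
  does not pay, so charging for used rather than for purchased amounts changes nothing at \<open>(N, r)\<close>.
  Paying every producer for the bundle \<open>b\<^sup>i\<close> and for a share \<open>r d\<^sub>i / \<Sum> d\<close> of the common pool then gives
  a core element, because \<open>R\<^sup>p\<^sup>e\<^sup>s(S) \<le> (r - \<Sum>\<^bsub>i \<notin> S\<^esub> d\<^sub>i)\<^sub>+\<close>: these shares are a core element
  of the bankruptcy game with claims \<open>d\<^sub>i\<close> and estate \<open>r\<close>.

  Strong duality is only needed under Slater's condition, which \<open>x = 0\<close> satisfies for \<open>r > 0\<close>;
  for \<open>r = 0\<close> the game vanishes.
\<close>

section \<open>Compact feasible sets and linear programming duality\<close>

text \<open>A row of \<open>T\<close> with a positive entry for good \<open>j\<close> caps
  \<open>x $ j\<close>, as its other terms are nonnegative. The choice of \<open>T\<close> covers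
  the problem both with and without the common-pool row.\<close>

lemma compact_nonneg_polyhedron:
  fixes A :: "real^'g::finite^'m::finite"
  assumes "\<And>t j. 0 \<le> A $ t $ j" and "\<And>j. \<exists>t\<in>T. 0 < A $ t $ j"
  shows "compact {x. 0 \<le> x \<and> (\<forall>t\<in>T. (A *v x) $ t \<le> u t)}" (is "compact ?K")
proof -
  obtain \<tau> where \<tau>: "\<And>j. \<tau> j \<in> T" "\<And>j. 0 < A $ \<tau> j $ j"
    using assms(2) by metis
  have "?K = (\<Inter>j. {x. 0 \<le> x $ j}) \<inter> (\<Inter>t\<in>T. {x. (A *v x) $ t \<le> u t})"
    by (auto simp: less_eq_vec_def)
  moreover have "closed {x. 0 \<le> (x::real^'g) $ j}" for j
    by (intro closed_Collect_le continuous_intros)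
  moreover have "closed {x. (A *v x) $ t \<le> u t}" for t
    unfolding matrix_vector_mult_def by (simp, intro closed_Collect_le continuous_intros)
  ultimately have "closed ?K"
    by (simp add: closed_INT closed_Int)
  moreover have "?K \<subseteq> cbox 0 (\<chi> j. u (\<tau> j) / A $ \<tau> j $ j)"
  proof
    fix x assume x: "x \<in> ?K"
    have "x $ j \<le> u (\<tau> j) / A $ \<tau> j $ j" for j
    proof -
      have "A $ \<tau> j $ j * x $ j \<le> (A *v x) $ \<tau> j"
        unfolding matrix_vector_mult_def using x assms(1)
        by (simp, intro member_le_sum) (auto simp: less_eq_vec_def)
      also have "\<dots> \<le> u (\<tau> j)"
        using x \<tau> by blast
      finally show ?thesis
        using \<tau>(2) by (simp add: field_simps)
    qed
    then show "x \<in> cbox 0 (\<chi> j. u (\<tau> j) / A $ \<tau> j $ j)"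
      using x by (simp add: mem_box_cart less_eq_vec_def)
  qed
  ultimately show ?thesis
    using bounded_cbox bounded_subset compact_eq_bounded_closed by blast
qed

lemma inner_mono_vec:
  fixes a u v :: "real^'m::finite"
  assumes "0 \<le> a" and "u \<le> v"
  shows "a \<bullet> u \<le> a \<bullet> v"
  using assms by (auto simp: inner_vec_def less_eq_vec_def intro!: sum_mono mult_left_mono)

text \<open>A hyperplane separates the pairs (resources, profit) that plans attain or dominate from
  the vertical ray above the optimum at \<open>k\<close>; its rescaled normal is the price vector.
  The second conclusion is dual feasibility, tested against all plans.\<close>

lemma lp_strong_duality_slater:
  fixes A :: "real^'g::finite^'m::finite" and \<pi> x\<^sub>0 :: "real^'g" and k :: "real^'m"
  assumes kpos: "\<And>t. 0 < k $ t"
    and x0: "0 \<le> x\<^sub>0" "A *v x\<^sub>0 \<le> k"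
    and opt: "\<And>x. 0 \<le> x \<Longrightarrow> A *v x \<le> k \<Longrightarrow> \<pi> \<bullet> x \<le> \<pi> \<bullet> x\<^sub>0"
  obtains y :: "real^'m" where "0 \<le> y" and "\<And>x. 0 \<le> x \<Longrightarrow> \<pi> \<bullet> x \<le> y \<bullet> (A *v x)"
    and "y \<bullet> k = \<pi> \<bullet> x\<^sub>0"
proof -
  define V where "V = \<pi> \<bullet> x\<^sub>0"
  define C where "C = {(u, s). \<exists>x\<ge>0. A *v x \<le> u \<and> s \<le> \<pi> \<bullet> x}"
  define D where "D = {k} \<times> {V<..}"
  have "convex C"
    unfolding convex_def C_def
  proof (clarsimp)
    fix u s u' s' x x' and a b :: real
    assume *: "0 \<le> x" "A *v x \<le> u" "s \<le> \<pi> \<bullet> x" "0 \<le> x'" "A *v x' \<le> u'" "s' \<le> \<pi> \<bullet> x'"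
      "0 \<le> a" "0 \<le> b" "a + b = 1"
    show "\<exists>w\<ge>0. A *v w \<le> a *\<^sub>R u + b *\<^sub>R u' \<and> a * s + b * s' \<le> \<pi> \<bullet> w"
    proof (intro exI conjI)
      show "0 \<le> a *\<^sub>R x + b *\<^sub>R x'"
        using * by (auto simp: less_eq_vec_def)
      show "A *v (a *\<^sub>R x + b *\<^sub>R x') \<le> a *\<^sub>R u + b *\<^sub>R u'"
        using * by (auto simp: matrix_vector_right_distrib matrix_vector_mult_scaleR less_eq_vec_def
            intro!: add_mono mult_left_mono)
      show "a * s + b * s' \<le> \<pi> \<bullet> (a *\<^sub>R x + b *\<^sub>R x')"
        using * by (auto simp: inner_add_right intro!: add_mono mult_left_mono)
    qed
  qed
  moreover have "convex D"
    unfolding D_def by (simp add: convex_Times)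
  moreover have C0: "(0, 0) \<in> C"
    unfolding C_def by (auto intro!: exI[of _ 0])
  moreover have "(k, V + 1) \<in> D"
    unfolding D_def by simp
  moreover have "C \<inter> D = {}"
    unfolding C_def D_def V_def using opt by fastforce
  ultimately obtain h e where h: "h \<noteq> 0" and C: "\<And>w. w \<in> C \<Longrightarrow> h \<bullet> w \<le> e"
    and D: "\<And>w. w \<in> D \<Longrightarrow> e \<le> h \<bullet> w"
    using separating_hyperplane_sets[of C D] by blast
  obtain \<alpha> \<beta> where hab: "h = (\<alpha>, \<beta>)" by (cases h)
  have Cx: "\<alpha> \<bullet> u + \<beta> * s \<le> e" if "0 \<le> x" "A *v x \<le> u" "s \<le> \<pi> \<bullet> x" for x u s
    using C[of "(u, s)"] that unfolding C_def hab by auto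
  have Dx: "e \<le> \<alpha> \<bullet> k + \<beta> * s" if "V < s" for s
    using D[of "(k, s)"] that unfolding D_def hab by auto
  have "0 \<le> e"
    using C[OF C0] by (simp add: zero_prod_def[symmetric])
  \<comment> \<open>\<open>C\<close> is unbounded downwards in the profit and, for
    \<open>\<alpha>\<close> below, upwards in the resources; this fixes the signs of the
    normal.\<close>
  have "0 \<le> \<beta>"
  proof (rule ccontr)
    assume "\<not> 0 \<le> \<beta>"
    then have "\<beta> * min 0 ((e + 1) / \<beta>) > e"
      using \<open>0 \<le> e\<close> by (auto simp: min_def field_simps)
    then show False
      using Cx[of 0 0 "min 0 ((e + 1) / \<beta>)"] by simp
  qed
  have \<alpha>: "\<alpha> $ t \<le> 0" for t
  proof (rule ccontr)
    assume *: "\<not> \<alpha> $ t \<le> 0"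
    define u where "u = axis t ((e + 1) / \<alpha> $ t)"
    have "0 \<le> u"
      using * \<open>0 \<le> e\<close> by (auto simp: u_def axis_def less_eq_vec_def)
    then have "\<alpha> \<bullet> u \<le> e"
      using Cx[of 0 u 0] by simp
    then show False
      using * by (simp add: u_def inner_axis)
  qed
  \<comment> \<open>Slater's condition rules out a vertical hyperplane: it would give
    \<open>0 \<le> \<alpha> \<bullet> k\<close> with \<open>\<alpha> \<le> 0\<close> and
    \<open>k\<close> positive, hence \<open>\<alpha> = 0\<close>.\<close>
  have "\<beta> \<noteq> 0"
  proof
    assume b0: "\<beta> = 0"
    have "0 \<le> (\<Sum>t\<in>UNIV. \<alpha> $ t * k $ t)"
      using Dx[of "V + 1"] b0 \<open>0 \<le> e\<close> by (simp add: inner_vec_def)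
    moreover have "\<alpha> $ t * k $ t \<le> 0" for t
      using \<alpha>[of t] kpos[of t] by (simp add: mult_nonpos_nonneg)
    ultimately have "(\<Sum>t\<in>UNIV. - (\<alpha> $ t * k $ t)) = 0"
      using sum_nonpos[of UNIV "\<lambda>t. \<alpha> $ t * k $ t"] by (simp add: sum_negf)
    then have "\<forall>t\<in>UNIV. - (\<alpha> $ t * k $ t) = 0"
      using \<open>\<And>t. \<alpha> $ t * k $ t \<le> 0\<close> by (subst (asm) sum_nonneg_eq_0_iff) auto
    then have "\<alpha> = 0"
      using kpos by (auto simp: vec_eq_iff) (metis less_irrefl)
    then show False
      using h b0 hab by (simp add: zero_prod_def)
  qed
  then have \<beta>: "0 < \<beta>" using \<open>0 \<le> \<beta>\<close> by simp
  define y where "y = (- inverse \<beta>) *\<^sub>R \<alpha>"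
  have y: "\<alpha> = - (\<beta> *\<^sub>R y)"
    using \<beta> by (simp add: y_def)
  have "e \<le> \<alpha> \<bullet> k + \<beta> * V"
  proof (rule field_le_epsilon)
    fix \<epsilon> :: real assume "0 < \<epsilon>"
    moreover from this have "\<beta> * (V + \<epsilon> / \<beta>) = \<beta> * V + \<epsilon>"
      using \<beta> by (simp add: distrib_left)
    ultimately show "e \<le> \<alpha> \<bullet> k + \<beta> * V + \<epsilon>"
      using Dx[of "V + \<epsilon> / \<beta>"] \<beta> by simp
  qed
  then have main: "\<pi> \<bullet> x - y \<bullet> (A *v x) \<le> V - y \<bullet> k" if "0 \<le> x" for x
  proof -
    have "\<beta> * (\<pi> \<bullet> x - y \<bullet> (A *v x)) \<le> \<beta> * (V - y \<bullet> k)"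
      using Cx[of x "A *v x" "\<pi> \<bullet> x"] that \<open>e \<le> \<alpha> \<bullet> k + \<beta> * V\<close>
      by (simp add: y algebra_simps)
    then show ?thesis using \<beta> by simp
  qed
  have "0 \<le> y"
    using \<alpha> \<beta> by (auto simp: y_def less_eq_vec_def mult_nonneg_nonpos)
  moreover have "\<pi> \<bullet> x \<le> y \<bullet> (A *v x)" if "0 \<le> x" for x
  proof (rule ccontr)
    \<comment> \<open>\<open>main\<close> bounds the gap by a constant on the whole cone of plans,
      so a positive gap is scaled beyond it; \<open>m\<close> makes the scaled gap exceed the
      constant by 1.\<close>
    define \<delta> where "\<delta> = \<pi> \<bullet> x - y \<bullet> (A *v x)"
    assume "\<not> ?thesis"
    then have \<delta>: "0 < \<delta>" by (simp add: \<delta>_def)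
    define m where "m = (V - y \<bullet> k + 1) / \<delta>"
    have "0 \<le> V - y \<bullet> k"
      using main[of 0] by simp
    then have "0 \<le> m"
      using \<delta> by (simp add: m_def)
    then have "0 \<le> m *\<^sub>R x"
      using that by (simp add: less_eq_vec_def)
    from main[OF this] have "m * \<delta> \<le> V - y \<bullet> k"
      by (simp add: \<delta>_def matrix_vector_mult_scaleR algebra_simps)
    then show False
      using \<delta> by (simp add: m_def)
  qed
  moreover from this have "y \<bullet> k = V"
    using main[of 0] x0 inner_mono_vec[OF \<open>0 \<le> y\<close> x0(2)] unfolding V_def by force
  ultimately show thesis
    using that unfolding V_def by blast
qed

section \<open>Value functions and optimal demands of coalitions\<close>

context lpp_situation
begin

abbreviation "val \<equiv> lp_value A B p c"
abbreviation "d \<equiv> optimal_demand A B p c"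
abbreviation "R \<equiv> pessimistic_resource A B p r c"

text \<open>Unit profits when the common pool is paid for by use. This objective does not depend on
  the purchased amount \<open>z\<close>.\<close>

definition margin :: "real^'g" where
  "margin = (\<chi> j. p $ j - c * A $ None $ j)"

lemma margin_inner: "margin \<bullet> x = p \<bullet> x - c * (A *v x) $ None"
  by (simp add: margin_def inner_vec_def matrix_vector_mult_def sum_distrib_left
      sum_subtractf algebra_simps)

lemma coalition_resources_nth: "coalition_resources B S $ t = (\<Sum>i\<in>S. B $ t $ i)"
  by (simp add: coalition_resources_def column_def)

lemma coalition_resources_nonneg: "0 \<le> coalition_resources B S $ t"
  using B_nonneg by (simp add: coalition_resources_nth sum_nonneg)

lemma le_capacity_iff:
  "u \<le> capacity B S z \<longleftrightarrow> (\<forall>t. u $ Some t \<le> coalition_resources B S $ t) \<and> u $ None \<le> z"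
proof
  assume L: "u \<le> capacity B S z"
  then have "u $ w \<le> capacity B S z $ w" for w
    by (simp add: less_eq_vec_def)
  from this[of None] this[of "Some _"]
  show "(\<forall>t. u $ Some t \<le> coalition_resources B S $ t) \<and> u $ None \<le> z"
    by (simp add: capacity_def)
qed (auto simp: less_eq_vec_def capacity_def split: option.splits)

lemma lp_value_attained:
  assumes "0 \<le> z"
  obtains x where "0 \<le> x" "A *v x \<le> capacity B S z" "val S z = p \<bullet> x - c * z"
    "\<And>x'. 0 \<le> x' \<Longrightarrow> A *v x' \<le> capacity B S z \<Longrightarrow> p \<bullet> x' - c * z \<le> val S z"
proof -
  define K where "K = {x. 0 \<le> x \<and> (\<forall>t\<in>UNIV. (A *v x) $ t \<le> capacity B S z $ t)}"
  have K: "x \<in> K \<longleftrightarrow> 0 \<le> x \<and> A *v x \<le> capacity B S z" for x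
    by (auto simp: K_def less_eq_vec_def)
  have "compact K"
    unfolding K_def using A_nonneg common_pool_needed by (intro compact_nonneg_polyhedron) auto
  moreover have "0 \<in> K"
    unfolding K using assms coalition_resources_nonneg by (simp add: le_capacity_iff)
  moreover have "continuous_on K (\<lambda>x. p \<bullet> x)"
    by (intro continuous_intros)
  ultimately obtain x where x: "x \<in> K" "\<And>x'. x' \<in> K \<Longrightarrow> p \<bullet> x' \<le> p \<bullet> x"
    using continuous_attains_sup[of K "\<lambda>x. p \<bullet> x"] by blast
  have "val S z = p \<bullet> x - c * z"
    unfolding lp_value_def using x K by (intro Greatest_equality) (auto simp: inner_vec_def)
  with x K that show thesis by auto
qed

lemma lp_value_le_margin:
  assumes "0 \<le> z"
  obtains x where "0 \<le> x" "A *v x \<le> capacity B S z" "val S z \<le> margin \<bullet> x"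
proof -
  obtain x where x: "0 \<le> x" "A *v x \<le> capacity B S z" "val S z = p \<bullet> x - c * z"
    using lp_value_attained[OF assms] by metis
  have "c * (A *v x) $ None \<le> c * z"
    using x c_nonneg by (simp add: le_capacity_iff mult_left_mono)
  with x that show thesis
    by (simp add: margin_inner)
qed

lemma pool_use_nonneg: "0 \<le> x \<Longrightarrow> 0 \<le> (A *v x) $ None"
  using A_nonneg by (auto simp: matrix_vector_mult_def less_eq_vec_def intro!: sum_nonneg)

text \<open>If exactly the used amount is bought, both ways of charging for the pool agree.\<close>

lemma margin_le_lp_value:
  assumes "0 \<le> x" "A *v x \<le> capacity B S ((A *v x) $ None)"
  shows "margin \<bullet> x \<le> val S ((A *v x) $ None)"
  using lp_value_attained[OF pool_use_nonneg[OF assms(1)], of S] assms margin_inner[of x] by metis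

text \<open>Optimizing over \<open>z\<close> as well amounts to maximizing \<open>margin\<close>
  without the pool constraint. The demand is the least pool use among the maximizers, so
  \<open>GREATEST\<close> and \<open>LEAST\<close> are both attained.\<close>

lemma optimal_demand_attained:
  shows "0 \<le> d S" and "0 \<le> z \<Longrightarrow> val S z \<le> val S (d S)"
proof -
  \<comment> \<open>The pool amount 0 is a dummy, since only the rows \<open>Some t\<close> are
    imposed.\<close>
  define K where
    "K = {x. 0 \<le> x \<and> (\<forall>t\<in>range Some. (A *v x) $ t \<le> capacity B S 0 $ t)}"
  have K: "x \<in> K \<longleftrightarrow> 0 \<le> x \<and> (\<forall>t. (A *v x) $ Some t \<le> coalition_resources B S $ t)" for x
    by (auto simp: K_def capacity_def)
  have cK: "compact K"
    unfolding K_def using A_nonneg resource_needed by (intro compact_nonneg_polyhedron) auto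
  moreover have "0 \<in> K"
    unfolding K using coalition_resources_nonneg by simp
  moreover have "continuous_on K (\<lambda>x. margin \<bullet> x)"
    by (intro continuous_intros)
  ultimately obtain x0 where x0: "x0 \<in> K" "\<And>x. x \<in> K \<Longrightarrow> margin \<bullet> x \<le> margin \<bullet> x0"
    using continuous_attains_sup[of K "\<lambda>x. margin \<bullet> x"] by blast
  define W where "W = margin \<bullet> x0"
  have dominated: "\<exists>x\<in>K. val S z \<le> margin \<bullet> x \<and> (A *v x) $ None \<le> z" if z: "0 \<le> z" for z
  proof -
    obtain x where "0 \<le> x" "A *v x \<le> capacity B S z" "val S z \<le> margin \<bullet> x"
      using lp_value_le_margin[OF z] .
    then show ?thesis
      by (intro bexI[of _ x]) (simp_all add: K le_capacity_iff)
  qed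
  have le_W: "val S z \<le> W" if "0 \<le> z" for z
    using dominated[OF that] x0(2) unfolding W_def by (meson order_trans)
  have val_eq_W: "\<exists>x\<in>K. margin \<bullet> x = W \<and> (A *v x) $ None \<le> z"
    if "0 \<le> z" "val S z = W" for z
    using dominated[OF that(1)] x0(2) that(2) unfolding W_def by (metis antisym)
  have val_W: "val S ((A *v x) $ None) = W" if "x \<in> K" "margin \<bullet> x = W" for x
  proof -
    have "0 \<le> x" "A *v x \<le> capacity B S ((A *v x) $ None)"
      using that by (auto simp: K le_capacity_iff)
    then have "W \<le> val S ((A *v x) $ None)"
      using margin_le_lp_value that(2) by metis
    moreover have "val S ((A *v x) $ None) \<le> W"
      using le_W pool_use_nonneg[OF \<open>0 \<le> x\<close>] .
    ultimately show ?thesis by (rule antisym[rotated])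
  qed
  have great: "(GREATEST v. \<exists>z'\<ge>0. v = val S z') = W"
  proof (rule Greatest_equality)
    have "0 \<le> (A *v x0) $ None"
      using x0(1) pool_use_nonneg by (simp add: K)
    moreover have "val S ((A *v x0) $ None) = W"
      using val_W x0(1) by (simp add: W_def)
    ultimately show "\<exists>z'\<ge>0. W = val S z'"
      by metis
  qed (use le_W in blast)
  \<comment> \<open>The optimal face is compact, so some plan \<open>x1\<close> on it uses the least
    of the pool.\<close>
  define L where "L = K \<inter> {x. margin \<bullet> x = W}"
  have "compact L"
    unfolding L_def using cK by (intro compact_Int_closed closed_Collect_eq continuous_intros)
  moreover have "x0 \<in> L"
    using x0 by (simp add: L_def W_def)
  moreover have "continuous_on L (\<lambda>x. (A *v x) $ None)"
    unfolding matrix_vector_mult_def by (simp, intro continuous_intros)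
  ultimately obtain x1 where x1: "x1 \<in> L" "\<And>x. x \<in> L \<Longrightarrow> (A *v x1) $ None \<le> (A *v x) $ None"
    using continuous_attains_inf[of L "\<lambda>x. (A *v x) $ None"] by blast
  have x1': "0 \<le> (A *v x1) $ None" "val S ((A *v x1) $ None) = W"
    using x1(1) val_W[of x1] pool_use_nonneg[of x1] by (simp_all add: L_def K)
  have "d S = (A *v x1) $ None"
    unfolding optimal_demand_def great
  proof (rule Least_equality)
    fix z assume "0 \<le> z \<and> val S z = W"
    then obtain x where "x \<in> K" "margin \<bullet> x = W" "(A *v x) $ None \<le> z"
      using val_eq_W by blast
    then show "(A *v x1) $ None \<le> z"
      using x1(2)[of x] by (simp add: L_def)
  qed (use x1' in auto)
  with x1' le_W show "0 \<le> d S" and "0 \<le> z \<Longrightarrow> val S z \<le> val S (d S)"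
    by auto
qed

lemma lp_value_concave:
  assumes "0 \<le> z" "0 \<le> z'" "0 \<le> a" "0 \<le> b" "a + b = 1"
  shows "a * val S z + b * val S z' \<le> val S (a * z + b * z')"
proof -
  obtain x where x: "0 \<le> x" "A *v x \<le> capacity B S z" "val S z = p \<bullet> x - c * z"
    using lp_value_attained[OF assms(1)] by metis
  obtain x' where x': "0 \<le> x'" "A *v x' \<le> capacity B S z'" "val S z' = p \<bullet> x' - c * z'"
    using lp_value_attained[OF assms(2)] by metis
  let ?x = "a *\<^sub>R x + b *\<^sub>R x'"
  have "0 \<le> ?x"
    using x x' assms by (auto simp: less_eq_vec_def)
  moreover have "A *v ?x \<le> capacity B S (a * z + b * z')"
    unfolding le_capacity_iff
  proof (intro conjI allI)
    fix t
    have "a * (A *v x) $ Some t + b * (A *v x') $ Some t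
      \<le> a * coalition_resources B S $ t + b * coalition_resources B S $ t"
      using x x' assms by (intro add_mono mult_left_mono) (auto simp: le_capacity_iff)
    also have "\<dots> = coalition_resources B S $ t"
      using assms(5) by (simp flip: distrib_right)
    finally show "(A *v ?x) $ Some t \<le> coalition_resources B S $ t"
      by (simp add: matrix_vector_right_distrib matrix_vector_mult_scaleR)
    show "(A *v ?x) $ None \<le> a * z + b * z'"
      using x x' assms by (auto simp: le_capacity_iff matrix_vector_right_distrib
          matrix_vector_mult_scaleR intro!: add_mono mult_left_mono)
  qed
  moreover have "0 \<le> a * z + b * z'"
    using assms by simp
  ultimately have "p \<bullet> ?x - c * (a * z + b * z') \<le> val S (a * z + b * z')"
    using lp_value_attained by metis
  then show ?thesis
    by (simp add: x x' inner_add_right algebra_simps)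
qed

text \<open>A concave function does not decrease on the way to its maximum; \<open>b\<close> below
  is the weight of \<open>d S\<close> when \<open>z'\<close> is written as a mixture of
  \<open>z\<close> and \<open>d S\<close>.\<close>

lemma lp_value_mono_upto_demand:
  assumes "0 \<le> z" "z \<le> z'" "z' \<le> d S"
  shows "val S z \<le> val S z'"
proof (cases "z' = z")
  case False
  then have *: "z < d S" using assms by simp
  define b where "b = (z' - z) / (d S - z)"
  have b: "0 \<le> b" "b \<le> 1"
    using assms * by (auto simp: b_def)
  have z': "z' = (1 - b) * z + b * d S"
  proof -
    have "b * (d S - z) = z' - z"
      using * by (simp add: b_def)
    then show ?thesis by (simp add: algebra_simps)
  qed
  have "(1 - b) * val S z + b * val S (d S) \<le> val S z'"
    unfolding z' using lp_value_concave[of z "d S" "1 - b" b S] assms b by simp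
  moreover have "b * val S z \<le> b * val S (d S)"
    using b optimal_demand_attained(2)[OF assms(1)] by (simp add: mult_left_mono)
  ultimately show ?thesis
    by (simp add: left_diff_distrib)
qed simp

text \<open>Every good consumes the common pool, so without it only \<open>x = 0\<close> is
  feasible.\<close>

lemma lp_value_zero: "val S 0 = 0"
proof -
  obtain x where x: "0 \<le> x" "A *v x \<le> capacity B S 0" "val S 0 = p \<bullet> x - c * 0"
    using lp_value_attained[of 0 S] by (metis order_refl)
  have nn: "0 \<le> A $ None $ j * x $ j" for j
    using x A_nonneg by (simp add: less_eq_vec_def)
  have "(\<Sum>j\<in>UNIV. A $ None $ j * x $ j) \<le> 0"
    using x by (simp add: le_capacity_iff matrix_vector_mult_def)
  then have "(\<Sum>j\<in>UNIV. A $ None $ j * x $ j) = 0"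
    using nn by (simp add: antisym sum_nonneg)
  then have "A $ None $ j * x $ j = 0" for j
    using nn by (simp add: sum_nonneg_eq_0_iff)
  then have "x = 0"
    using common_pool_needed by (auto simp: vec_eq_iff) (metis less_irrefl)
  then show ?thesis
    using x by simp
qed

section \<open>Bounds on the pessimistic resource amounts\<close>

lemma pessimistic_resource_UNIV:
  assumes "r < d UNIV"
  shows "R UNIV = r"
proof -
  have "P = {UNIV}" if "partition_on UNIV P" "UNIV \<in> P" for P :: "'n set set"
  proof -
    have "T = UNIV" if "T \<in> P" for T
      using \<open>partition_on UNIV P\<close> \<open>UNIV \<in> P\<close> that
      unfolding partition_on_def disjoint_def by (metis Int_UNIV_left)
    then show ?thesis using that by auto
  qed
  moreover have "partition_on UNIV {UNIV :: 'n set}"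
    by (simp add: partition_on_def)
  ultimately have "{P. partition_on UNIV P \<and> UNIV \<in> P} = {{UNIV :: 'n set}}"
    by blast
  then show ?thesis
    using assms r_nonneg by (simp add: pessimistic_resource_def)
qed

lemma pessimistic_resource_bounds:
  assumes "S \<noteq> {}"
  shows "0 \<le> R S" and "R S \<le> max (r - (\<Sum>i\<in>-S. d {i})) 0"
proof -
  \<comment> \<open>The partition that splits the outsiders into singletons already yields the upper
    bound.\<close>
  define P where "P = insert S ((\<lambda>i. {i}) ` (- S))"
  let ?M = "(\<lambda>P. max (r - (\<Sum>T\<in>P - {S}. d T)) 0) ` {P. partition_on UNIV P \<and> S \<in> P}"
  have fin: "finite ?M" by simp
  have "P - {S} = (\<lambda>i. {i}) ` (- S)"
    by (auto simp: P_def)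
  then have sum: "(\<Sum>T\<in>P - {S}. d T) = (\<Sum>i\<in>-S. d {i})"
    by (simp add: sum.reindex)
  have "partition_on UNIV P"
    using assms by (auto simp: P_def partition_on_def disjoint_def)
  then have P: "max (r - (\<Sum>i\<in>-S. d {i})) 0 \<in> ?M"
    unfolding sum[symmetric] by (intro imageI) (simp add: P_def)
  then have "Min ?M \<le> max (r - (\<Sum>i\<in>-S. d {i})) 0"
    using fin by (intro Min_le)
  then show "R S \<le> max (r - (\<Sum>i\<in>-S. d {i})) 0"
    unfolding pessimistic_resource_def by linarith
  have "0 \<le> Min ?M"
    using P fin by (subst Min_ge_iff) auto
  then show "0 \<le> R S"
    using optimal_demand_attained(1)[of S] by (simp add: pessimistic_resource_def)
qed

section \<open>Construction of a core element\<close>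

lemma core_nonempty_if_scarce:
  assumes scarce: "r < d UNIV" and claims: "r \<le> (\<Sum>i\<in>UNIV. d {i})"
  shows "core (pessimistic_game A B p r c) \<noteq> {}"
proof (cases "r = 0")
  case True
  have "R S = 0" if "S \<noteq> {}" for S
    using pessimistic_resource_bounds[OF that] True
      sum_nonneg[of "-S" "\<lambda>i. d {i}"] optimal_demand_attained(1) by force
  then have "(0 :: real^'n) \<in> core (pessimistic_game A B p r c)"
    by (auto simp: core_def pessimistic_game_def lp_value_zero)
  then show ?thesis by blast
next
  case False
  then have r: "0 < r" using r_nonneg by simp
  define k where "k = capacity B UNIV r"
  have kpos: "0 < k $ t" for t
  proof (cases t)
    case (Some s)
    obtain i where "0 < B $ s $ i" using resource_owned by blast
    then have "0 < (\<Sum>i\<in>UNIV. B $ s $ i)"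
      using B_nonneg by (intro sum_pos2) auto
    then show ?thesis
      using Some by (simp add: k_def capacity_def coalition_resources_nth)
  qed (simp add: k_def capacity_def r)
  define K where "K = {x. 0 \<le> x \<and> (\<forall>t\<in>UNIV. (A *v x) $ t \<le> k $ t)}"
  have K: "x \<in> K \<longleftrightarrow> 0 \<le> x \<and> A *v x \<le> k" for x
    by (auto simp: K_def less_eq_vec_def)
  have "compact K"
    unfolding K_def using A_nonneg common_pool_needed by (intro compact_nonneg_polyhedron) auto
  moreover have "0 \<in> K"
    unfolding K using kpos by (simp add: less_eq_vec_def less_imp_le)
  moreover have "continuous_on K (\<lambda>x. margin \<bullet> x)"
    by (intro continuous_intros)
  ultimately obtain x0 where x0: "x0 \<in> K" "\<And>x. x \<in> K \<Longrightarrow> margin \<bullet> x \<le> margin \<bullet> x0"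
    using continuous_attains_sup[of K "\<lambda>x. margin \<bullet> x"] by blast
  obtain y where y: "0 \<le> y" "\<And>x. 0 \<le> x \<Longrightarrow> margin \<bullet> x \<le> y \<bullet> (A *v x)"
    and yk: "y \<bullet> k = margin \<bullet> x0"
    using lp_strong_duality_slater[of k x0 A margin] kpos x0 K by metis
  \<comment> \<open>Dual feasibility does not involve the capacities, so the grand coalition's
    prices serve every coalition and every \<open>z\<close>.\<close>
  have bound: "val S z \<le> y \<bullet> capacity B S z" if z: "0 \<le> z" for S z
  proof -
    obtain x where x: "0 \<le> x" "A *v x \<le> capacity B S z" "val S z \<le> margin \<bullet> x"
      using lp_value_le_margin[OF z] .
    note x(3)
    also have "\<dots> \<le> y \<bullet> (A *v x)"
      using y x by blast
    also have "\<dots> \<le> y \<bullet> capacity B S z"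
      using inner_mono_vec y x by blast
    finally show ?thesis .
  qed
  have grand: "val UNIV r = y \<bullet> k"
  proof (rule antisym)
    show "val UNIV r \<le> y \<bullet> k"
      using bound r by (simp add: k_def)
    \<comment> \<open>\<open>x0\<close> may use less than \<open>r\<close>. Its profit is attained
      by buying only \<open>z\<close>, and buying up to \<open>r\<close> loses nothing because
      \<open>r\<close> lies below the demand of \<open>UNIV\<close>.\<close>
    define z where "z = (A *v x0) $ None"
    have x: "0 \<le> x0" "A *v x0 \<le> capacity B UNIV z" "z \<le> r"
      using x0 by (auto simp: K k_def z_def le_capacity_iff)
    have "0 \<le> z"
      unfolding z_def using x(1) by (rule pool_use_nonneg)
    have "margin \<bullet> x0 \<le> val UNIV z"
      using margin_le_lp_value x unfolding z_def by blast
    also have "\<dots> \<le> val UNIV r"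
      using lp_value_mono_upto_demand \<open>0 \<le> z\<close> x scarce by simp
    finally show "y \<bullet> k \<le> val UNIV r"
      by (simp add: yk)
  qed
  define D where "D = (\<Sum>i\<in>UNIV. d {i})"
  \<comment> \<open>The proportional division of \<open>r\<close>; \<open>r \<le> D\<close> keeps
    each share within its claim.\<close>
  define \<rho> where "\<rho> i = r * d {i} / D" for i
  have D: "0 < D" "r \<le> D" using claims r by (auto simp: D_def)
  have \<rho>_nonneg: "0 \<le> \<rho> i" for i
    using D r optimal_demand_attained(1) by (simp add: \<rho>_def)
  have \<rho>_le: "\<rho> i \<le> d {i}" for i
  proof -
    have "r * d {i} \<le> D * d {i}"
      using D optimal_demand_attained(1) by (intro mult_right_mono)
    then show ?thesis using D by (simp add: \<rho>_def field_simps)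
  qed
  have \<rho>_UNIV: "sum \<rho> UNIV = r"
    using D by (simp add: \<rho>_def D_def flip: sum_divide_distrib sum_distrib_left)
  \<comment> \<open>Outsiders receive at most their claims, so \<open>S\<close> keeps at least what
    these claims leave of \<open>r\<close>.\<close>
  have R_le: "R S \<le> sum \<rho> S" if "S \<noteq> {}" for S
  proof -
    have "sum \<rho> S = r - sum \<rho> (- S)"
      using \<rho>_UNIV sum.union_disjoint[of S "- S" \<rho>] by (simp add: Compl_partition)
    moreover have "sum \<rho> (- S) \<le> (\<Sum>i\<in>-S. d {i})"
      using \<rho>_le by (intro sum_mono)
    moreover have "0 \<le> sum \<rho> S"
      using \<rho>_nonneg by (simp add: sum_nonneg)
    ultimately show ?thesis
      using pessimistic_resource_bounds(2)[OF that] by linarith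
  qed
  define X :: "real^'n" where "X = (\<chi> i. y \<bullet> capacity B {i} (\<rho> i))"
  \<comment> \<open>Capacities add up over producers in both private and pool components, so a
    coalition's total payoff is the price of its pooled capacity.\<close>
  have cap_sum: "(\<Sum>i\<in>S. capacity B {i} (\<rho> i)) = capacity B S (sum \<rho> S)" for S
    by (auto simp: vec_eq_iff capacity_def coalition_resources_nth split: option.splits)
  have X: "(\<Sum>i\<in>S. X $ i) = y \<bullet> capacity B S (sum \<rho> S)" for S
    by (simp add: X_def cap_sum flip: inner_sum_right)
  have "X \<in> core (pessimistic_game A B p r c)"
    unfolding core_def
  proof (intro CollectI conjI allI)
    show "(\<Sum>i\<in>UNIV. X $ i) = pessimistic_game A B p r c UNIV"
      using grand by (simp add: X \<rho>_UNIV pessimistic_game_def pessimistic_resource_UNIV[OF scarce] k_def)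
    fix S
    show "pessimistic_game A B p r c S \<le> (\<Sum>i\<in>S. X $ i)"
    proof (cases "S = {}")
      case False
      have "val S (R S) \<le> y \<bullet> capacity B S (R S)"
        using bound pessimistic_resource_bounds(1)[OF False] by blast
      also have "\<dots> \<le> y \<bullet> capacity B S (sum \<rho> S)"
        using R_le[OF False] y(1)
        by (intro inner_mono_vec) (auto simp: less_eq_vec_def capacity_def split: option.splits)
      finally show ?thesis
        using False by (simp add: X pessimistic_game_def)
    qed (simp add: pessimistic_game_def)
  qed
  then show ?thesis by blast
qed

end

theorem theorem23:
  fixes A :: "real^'g::finite^('q::finite option)"
    and B :: "real^'n::finite^'q"
    and p :: "real^'g"
    and r c :: real
  assumes "lpp_situation A B p r c"
    and "optimal_demand A B p c UNIV > r"
    and "(\<Sum>i\<in>UNIV. optimal_demand A B p c {i}) \<ge> r"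
  shows "core (pessimistic_game A B p r c) \<noteq> {}"
  using assms by (rule lpp_situation.core_nonempty_if_scarce)

end
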